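(* Let a coin with principal moments of inertia $0<I_x\le I_y<I_z$ rotate freely (torque-free), with conserved angular momentum whose coordinates in the reference frame are $L^r=\|L\|(\cos\alpha\sin\beta,\ \sin\alpha\sin\beta,\ \cos\beta)$, where $\|L\|>0$, $\alpha\in\mathbb{R}$, $0<\beta<\pi$. Let $(\varphi_t,\theta_t,\psi_t)$ be the solution of $$\frac{d\psi_t}{dt}=\|L\|\Big(\frac{\cos^2\varphi_t}{I_x}+\frac{\sin^2\varphi_t}{I_y}\Big),\qquad \frac{d\varphi_t}{dt}=\|L\|\cos\theta_t\Big(\frac{\cos^2\varphi_t}{I_x}+\frac{\sin^2\varphi_t}{I_y}-\frac1{I_z}\Big),\qquad \frac{d\theta_t}{dt}=\frac{\|L\|}{2}\Big(\frac1{I_x}-\frac1{I_y}\Big)\sin\theta_t\sin(2\varphi_t),$$ whose initial value $(\varphi_0,\theta_0,\psi_0)$ is given by the angles of the coin at time $0$. Then at every time $t$ the coordinates in the reference frame of the unit normal vector $n$ to the heads side are $$n^r(t)=\begin{pmatrix}-\cos\alpha\cos\beta\cos\psi_t\sin\theta_t+\sin\alpha\sin\psi_t\sin\theta_t+\cos\alpha\sin\beta\cos\theta_t\\ -\sin\alpha\cos\beta\cos\psi_t\sin\theta_t-\cos\alpha\sin\psi_t\sin\theta_t+\sin\alpha\sin\beta\cos\theta_t\\ \sin\beta\cos\psi_t\sin\theta_t+\cos\beta\cos\theta_t\end{pmatrix}.$$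
   Context: Frames, all centered at the centroid of the coin, orthonormal and right-handed. Reference frame $\{i,j,k\}$: fixed in time, with $-k$ the direction of gravity. Body-fixed frame $\{e_1,e_2,n\}$: attached to the coin, with $n$ the unit normal to the heads side; in this frame the inertia matrix is $\mathrm{diag}(I_x,I_y,I_z)$. Torque-free motion: the angular momentum vector $L\neq0$ is constant in the reference frame; if $(L_x,L_y,L_z)$ are the coordinates of $L$ in the body-fixed frame at time $t$, the angular velocity is $\omega=\frac{L_x}{I_x}e_1+\frac{L_y}{I_y}e_2+\frac{L_z}{I_z}n$, and each body vector $e\in\{e_1,e_2,n\}$ satisfies $\dot e=\omega\times e$. Put $l=L/\|L\|$. Intermediate frame $\{\varepsilon_1,\varepsilon_2,l\}$: $\varepsilon_1=\frac{k-\langle k,l\rangle l}{\|k-\langle k,l\rangle l\|}$, $\varepsilon_2=l\times\varepsilon_1$. Angles of the coin at time $t$: $\theta_t\in[0,\pi]$ and $\varphi_t$ are the spherical angles of $l$ in the body-fixed frame, i.e. the body coordinates of $l$ are $(\cos\varphi_t\sin\theta_t,\sin\varphi_t\sin\theta_t,\cos\theta_t)$; in particular $\theta_t$ is the angle between $l$ and $n$. The angle $\psi_t$ is the longitude of $n$ in the intermediate frame, i.e. $n=\sin\theta_t\cos\psi_t\,\varepsilon_1+\sin\theta_t\sin\psi_t\,\varepsilon_2+\cos\theta_t\,l$. If $\theta_0\in\{0,\pi\}$, the values $\varphi_0,\psi_0$ may be chosen arbitrarily. *)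

theory Defs
  imports "HOL-Analysis.Analysis"
begin

unbundle cross3_syntax

text \<open>
  Physical space is \<^typ>\<open>real^3\<close> with its standard orientation. No frame is identified with the
  standard basis: the coordinates of a vector in a frame are its inner products with the frame
  vectors.
\<close>

definition right_handed_frame :: "real^3 \<Rightarrow> real^3 \<Rightarrow> real^3 \<Rightarrow> bool" where
  "right_handed_frame a b c \<longleftrightarrow>
     norm a = 1 \<and> norm b = 1 \<and> norm c = 1 \<and>
     a \<bullet> b = 0 \<and> a \<bullet> c = 0 \<and> b \<bullet> c = 0 \<and>
     a \<times> b = c"

definition frame_coords :: "real^3 \<Rightarrow> real^3 \<Rightarrow> real^3 \<Rightarrow> real^3 \<Rightarrow> real^3" where
  "frame_coords a b c v = vector [v \<bullet> a, v \<bullet> b, v \<bullet> c]"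

definition angular_velocity ::
    "real \<Rightarrow> real \<Rightarrow> real \<Rightarrow> real^3 \<Rightarrow> real^3 \<Rightarrow> real^3 \<Rightarrow> real^3 \<Rightarrow> real^3" where
  "angular_velocity Ix Iy Iz L e1 e2 n =
     ((L \<bullet> e1) / Ix) *\<^sub>R e1 + ((L \<bullet> e2) / Iy) *\<^sub>R e2 + ((L \<bullet> n) / Iz) *\<^sub>R n"

text \<open>
  The body-fixed frame \<open>(e1, e2, n)\<close> depends on time, ranging over the set \<open>T\<close>. Conservation of the
  angular momentum is expressed by \<open>L\<close> being a single vector, not a function of time.
\<close>

definition torque_free_motion ::
    "real set \<Rightarrow> real \<Rightarrow> real \<Rightarrow> real \<Rightarrow> real^3 \<Rightarrow>
     (real \<Rightarrow> real^3) \<Rightarrow> (real \<Rightarrow> real^3) \<Rightarrow> (real \<Rightarrow> real^3) \<Rightarrow> bool" where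
  "torque_free_motion T Ix Iy Iz L e1 e2 n \<longleftrightarrow>
     (\<forall>t\<in>T. right_handed_frame (e1 t) (e2 t) (n t) \<and>
        (let \<omega> = angular_velocity Ix Iy Iz L (e1 t) (e2 t) (n t) in
           (e1 has_vector_derivative \<omega> \<times> e1 t) (at t within T) \<and>
           (e2 has_vector_derivative \<omega> \<times> e2 t) (at t within T) \<and>
           (n has_vector_derivative \<omega> \<times> n t) (at t within T)))"

definition eps1 :: "real^3 \<Rightarrow> real^3 \<Rightarrow> real^3" where
  "eps1 k l = (k - (k \<bullet> l) *\<^sub>R l) /\<^sub>R norm (k - (k \<bullet> l) *\<^sub>R l)"

definition eps2 :: "real^3 \<Rightarrow> real^3 \<Rightarrow> real^3" where
  "eps2 k l = l \<times> eps1 k l"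

text \<open>
  The angles are a relation rather than functions of the frame: \<open>\<phi>\<close> and \<open>\<psi>\<close> are determined only
  up to multiples of \<open>2\<pi>\<close>, and are unconstrained when \<open>sin \<theta> = 0\<close>.
\<close>

definition coin_angles ::
    "real^3 \<Rightarrow> real^3 \<Rightarrow> real^3 \<Rightarrow> real^3 \<Rightarrow> real^3 \<Rightarrow> real \<Rightarrow> real \<Rightarrow> real \<Rightarrow> bool" where
  "coin_angles k L e1 e2 n \<phi> \<theta> \<psi> \<longleftrightarrow>
     (let l = L /\<^sub>R norm L in
        0 \<le> \<theta> \<and> \<theta> \<le> pi \<and>
        frame_coords e1 e2 n l = vector [cos \<phi> * sin \<theta>, sin \<phi> * sin \<theta>, cos \<theta>] \<and>
        n = (sin \<theta> * cos \<psi>) *\<^sub>R eps1 k l + (sin \<theta> * sin \<psi>) *\<^sub>R eps2 k l + cos \<theta> *\<^sub>R l)"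

end

theory Submission
  imports Defs
begin

text \<open>
  The body coordinates of \<open>l\<close> solve Euler's equations, and so do
  \<open>(cos \<phi> sin \<theta>, sin \<phi> sin \<theta>, cos \<theta>)\<close>; by uniqueness they agree at all times. Given this, both \<open>n\<close> and
  the vector \<open>m\<close> with spherical angles \<open>(\<theta>, \<psi>)\<close> in the intermediate frame satisfy the linear equation
  \<open>v' = B (l - cos \<theta> v) + \<parallel>L\<parallel> A (l \<times> v)\<close> with
  \<open>A = cos\<^sup>2 \<phi> / Ix + sin\<^sup>2 \<phi> / Iy\<close> and \<open>B = \<parallel>L\<parallel> (1 / Iy - 1 / Ix) cos \<phi> sin \<phi>\<close>, hence \<open>n = m\<close>. No division by
  \<open>sin \<theta>\<close> occurs, so the poles \<open>\<theta> \<in> {0, \<pi>}\<close> need no separate treatment.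
\<close>

section \<open>Gronwall-type vanishing on an interval\<close>

text \<open>The integrating factor \<open>exp (- C * t)\<close> turns \<open>g' \<le> C * g\<close>
  into a nonpositive derivative of the product \<open>h\<close>, so \<open>h\<close> cannot rise
  above \<open>h 0 = 0\<close>; the factor is positive, hence \<open>g\<close> inherits the
  sign.\<close>

lemma gronwall_zero_pos:
  fixes g :: "real \<Rightarrow> real"
  assumes d: "\<And>t. t \<in> {0..b} \<Longrightarrow> (g has_real_derivative g' t) (at t within {0..b})"
    and le: "\<And>t. t \<in> {0..b} \<Longrightarrow> g' t \<le> C * g t"
    and g0: "g 0 = 0" and b: "0 \<le> b"
  shows "g b \<le> 0"
proof -
  define h where "h = (\<lambda>t. exp (- C * t) * g t)"
  have h: "(h has_real_derivative exp (- C * t) * (g' t - C * g t)) (at t within {0..b})"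
    if "t \<in> {0..b}" for t
    unfolding h_def using d[OF that]
    by (auto intro!: derivative_eq_intros simp: algebra_simps)
  have "h b \<le> h 0"
  proof (rule DERIV_nonpos_imp_decreasing_open[OF b])
    fix t assume t: "0 < t" "t < b"
    have "(h has_real_derivative exp (- C * t) * (g' t - C * g t)) (at t)"
      using h[of t] t by (simp add: at_within_Icc_at)
    moreover have "exp (- C * t) * (g' t - C * g t) \<le> 0"
      using le[of t] t by (intro mult_nonneg_nonpos) auto
    ultimately show "\<exists>y. (h has_real_derivative y) (at t) \<and> y \<le> 0" by (intro exI conjI)
  next
    show "continuous_on {0..b} h"
      using h by (rule DERIV_continuous_on)
  qed
  then show ?thesis by (simp add: h_def g0 mult_le_0_iff)
qed

text \<open>Bounding \<bar>\<open>g'\<close>\<bar> makes the hypothesis invariant under time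
  reversal, so times on both sides of 0 reduce to the forward case. In the applications
  \<open>g\<close> is a squared distance between two solutions, and \<open>g t \<le> 0\<close>
  forces them to coincide.\<close>

lemma gronwall_zero:
  fixes g :: "real \<Rightarrow> real"
  assumes T: "is_interval T" "0 \<in> T"
    and d: "\<And>t. t \<in> T \<Longrightarrow> (g has_real_derivative g' t) (at t within T)"
    and le: "\<And>t. t \<in> T \<Longrightarrow> \<bar>g' t\<bar> \<le> C * g t"
    and g0: "g 0 = 0" and t: "t \<in> T"
  shows "g t \<le> 0"
proof (cases "0 \<le> t")
  case True
  have sub: "{0..t} \<subseteq> T"
    using T t mem_is_interval_1_I[of T 0 t] by auto
  show ?thesis
  proof (rule gronwall_zero_pos[where g = g and g' = g' and C = C])
    show "(g has_real_derivative g' s) (at s within {0..t})" if "s \<in> {0..t}" for s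
      using d[of s] that sub by (meson DERIV_subset subsetD)
    show "g' s \<le> C * g s" if "s \<in> {0..t}" for s
      using le[of s] that sub by force
  qed (use g0 True in auto)
next
  case False
  \<comment> \<open>The interval from \<open>t\<close> to 0 is written as an image under negation
    because the chain rule below differentiates \<open>g\<close> within exactly that image.\<close>
  have sub: "uminus ` {0..- t} \<subseteq> T"
    using T t False mem_is_interval_1_I[of T t 0] by auto
  have "g (- (- t)) \<le> 0"
  proof (rule gronwall_zero_pos[where g = "\<lambda>s. g (- s)" and g' = "\<lambda>s. - g' (- s)" and C = C])
    show "((\<lambda>s. g (- s)) has_real_derivative - g' (- s)) (at s within {0..- t})"
      if s: "s \<in> {0..- t}" for s
    proof -
      have "(g has_real_derivative g' (- s)) (at (- s) within uminus ` {0..- t})"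
        using d[of "- s"] s sub by (meson DERIV_subset imageI subsetD)
      moreover have "(uminus has_real_derivative - 1) (at s within {0..- t})"
        by (auto intro!: derivative_eq_intros)
      ultimately show ?thesis
        using DERIV_image_chain[of g "g' (- s)" uminus s "{0..- t}" "- 1"] by (simp add: o_def)
    qed
    show "- g' (- s) \<le> C * g (- s)" if "s \<in> {0..- t}" for s
    proof -
      have "- s \<in> T" using that sub by blast
      then show ?thesis using le[of "- s"] by linarith
    qed
  qed (use g0 False in auto)
  then show ?thesis by simp
qed

section \<open>Vector algebra of the reference, body and intermediate frames\<close>

lemma right_handed_frame_cross:
  assumes "right_handed_frame a b c"
  shows "a \<times> b = c" "b \<times> c = a" "c \<times> a = b" "b \<times> a = - c" "c \<times> b = - a" "a \<times> c = - b"
proof -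
  have ab: "a \<bullet> a = 1" "b \<bullet> b = 1" "a \<bullet> b = 0" "b \<bullet> a = 0" and c: "c = a \<times> b"
    using assms by (auto simp: right_handed_frame_def norm_eq_1 inner_commute)
  show 1: "a \<times> b = c" using c by simp
  show 2: "b \<times> c = a" unfolding c Lagrange using ab by simp
  have "a \<times> c = - b" unfolding c Lagrange using ab by simp
  then show 3: "c \<times> a = b" using cross_skew[of c a] by simp
  show "b \<times> a = - c" "c \<times> b = - a" "a \<times> c = - b"
    using 1 2 3 cross_skew by metis+
qed

text \<open>The double product \<open>c \<times> (v \<times> c)\<close> is evaluated twice:
  Lagrange's formula gives \<open>v\<close> minus its component along \<open>c\<close>, while
  expanding \<open>v \<times> c\<close> with \<open>c = a \<times> b\<close> first gives the
  components along \<open>a\<close> and \<open>b\<close>. This replaces a dimension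
  argument.\<close>

lemma right_handed_frame_expansion:
  assumes "right_handed_frame a b c"
  shows "v = (v \<bullet> a) *\<^sub>R a + (v \<bullet> b) *\<^sub>R b + (v \<bullet> c) *\<^sub>R c"
proof -
  note cr = right_handed_frame_cross[OF assms]
  have "v \<times> c = (v \<bullet> b) *\<^sub>R a - (v \<bullet> a) *\<^sub>R b"
    using Lagrange[of v a b] cr(1) by simp
  then have "c \<times> (v \<times> c) = (v \<bullet> b) *\<^sub>R b + (v \<bullet> a) *\<^sub>R a"
    by (simp add: Cross3.right_diff_distrib cr cross_mult_right)
  moreover have "c \<times> (v \<times> c) = v - (v \<bullet> c) *\<^sub>R c"
    using assms by (simp add: Lagrange right_handed_frame_def norm_eq_1 inner_commute)
  ultimately show ?thesis by (simp add: algebra_simps)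
qed

lemma frame_coords_eq_vector_iff:
  "frame_coords a b c v = vector [x, y, z] \<longleftrightarrow> v \<bullet> a = x \<and> v \<bullet> b = y \<and> v \<bullet> c = z"
  by (auto simp: frame_coords_def vec_eq_iff forall_3)

text \<open>Subtracting from \<open>k\<close> its component along \<open>l\<close> leaves
  \<open>sin \<beta>\<close> times a unit vector, and \<open>sin \<beta> > 0\<close> lets the
  normalization in \<open>eps1\<close> cancel this factor. The third identity, together with the
  definition of \<open>eps2\<close>, describes \<open>l \<times> _\<close> as a quarter turn of the
  plane orthogonal to \<open>l\<close>.\<close>

lemma intermediate_frame:
  assumes F: "right_handed_frame i j k" and beta: "0 < \<beta>" "\<beta> < pi"
    and l: "l = (cos \<alpha> * sin \<beta>) *\<^sub>R i + (sin \<alpha> * sin \<beta>) *\<^sub>R j + cos \<beta> *\<^sub>R k"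
  shows "eps1 k l = (- cos \<alpha> * cos \<beta>) *\<^sub>R i + (- sin \<alpha> * cos \<beta>) *\<^sub>R j + sin \<beta> *\<^sub>R k" (is "_ = ?e")
    and "eps2 k l = sin \<alpha> *\<^sub>R i - cos \<alpha> *\<^sub>R j"
    and "l \<times> eps2 k l = - eps1 k l"
proof -
  have F': "i \<bullet> i = 1" "j \<bullet> j = 1" "k \<bullet> k = 1" "i \<bullet> j = 0" "j \<bullet> i = 0" "i \<bullet> k = 0" "k \<bullet> i = 0"
    "j \<bullet> k = 0" "k \<bullet> j = 0"
    using F by (auto simp: right_handed_frame_def norm_eq_1 inner_commute)
  note cr = right_handed_frame_cross[OF F]
  have s: "sin \<beta> > 0" using beta by (simp add: sin_gt_zero)
  have kl: "k \<bullet> l = cos \<beta>" by (simp add: l inner_simps F')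
  have c2: "(cos x)\<^sup>2 = 1 - (sin x)\<^sup>2" for x :: real by (simp add: cos_squared_eq)
  have "k - cos \<beta> *\<^sub>R l = sin \<beta> *\<^sub>R ?e"
  proof -
    have "k - cos \<beta> *\<^sub>R l = (- (cos \<beta> * (cos \<alpha> * sin \<beta>))) *\<^sub>R i + (- (cos \<beta> * (sin \<alpha> * sin \<beta>))) *\<^sub>R j
      + (1 - (cos \<beta>)\<^sup>2) *\<^sub>R k"
      by (simp add: l algebra_simps power2_eq_square)
    also have "\<dots> = sin \<beta> *\<^sub>R ?e"
      unfolding c2 by (simp add: algebra_simps power2_eq_square)
    finally show ?thesis .
  qed
  moreover have ne: "norm ?e = 1"
  proof -
    have "?e \<bullet> ?e = (cos \<alpha>)\<^sup>2 * (cos \<beta>)\<^sup>2 + (sin \<alpha>)\<^sup>2 * (cos \<beta>)\<^sup>2 + (sin \<beta>)\<^sup>2"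
      by (simp add: inner_simps F' power2_eq_square algebra_simps)
    also have "\<dots> = 1" unfolding c2 by (simp add: algebra_simps)
    finally show ?thesis by (simp add: norm_eq_1)
  qed
  ultimately show e: "eps1 k l = ?e"
    using s by (simp only: eps1_def kl norm_scaleR) simp
  have cs: "(cos x)\<^sup>2 * y + (sin x)\<^sup>2 * y = y" for x y :: real
    by (simp flip: distrib_right)
  show f: "eps2 k l = sin \<alpha> *\<^sub>R i - cos \<alpha> *\<^sub>R j"
  proof -
    have "eps2 k l = (sin \<alpha> * sin \<beta> * sin \<beta> + cos \<beta> * (sin \<alpha> * cos \<beta>)) *\<^sub>R i
      - (cos \<alpha> * sin \<beta> * sin \<beta> + cos \<beta> * (cos \<alpha> * cos \<beta>)) *\<^sub>R j"
      unfolding eps2_def e unfolding l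
      by (simp add: cross_add_left cross_add_right cross_mult_left cross_mult_right
          Cross3.right_diff_distrib cr algebra_simps)
    also have "\<dots> = sin \<alpha> *\<^sub>R i - cos \<alpha> *\<^sub>R j"
    proof -
      have "x * sin \<beta> * sin \<beta> + cos \<beta> * (x * cos \<beta>) = x" for x
        using cs[of \<beta> x] by (simp add: power2_eq_square algebra_simps)
      then show ?thesis by simp
    qed
    finally show ?thesis .
  qed
  show "l \<times> eps2 k l = - eps1 k l"
  proof -
    have "l \<times> eps2 k l = (cos \<alpha> * cos \<beta>) *\<^sub>R i + (sin \<alpha> * cos \<beta>) *\<^sub>R j
       - ((cos \<alpha>)\<^sup>2 * sin \<beta> + (sin \<alpha>)\<^sup>2 * sin \<beta>) *\<^sub>R k"
      unfolding f unfolding l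
      by (simp add: cross_add_left cross_mult_left cross_mult_right Cross3.right_diff_distrib cr
          algebra_simps power2_eq_square)
    then show ?thesis by (simp add: cs e)
  qed
qed

section \<open>Uniqueness for Euler's equations and for the linear equation of the normal\<close>

text \<open>This Lipschitz estimate for products of numbers in [-1, 1] controls the quadratic
  right-hand sides of Euler's equations.\<close>

lemma abs_mult_diff_le:
  fixes a b a' b' :: real
  assumes "\<bar>b\<bar> \<le> 1" "\<bar>a'\<bar> \<le> 1"
  shows "\<bar>a * b - a' * b'\<bar> \<le> \<bar>a - a'\<bar> + \<bar>b - b'\<bar>"
proof -
  have "a * b - a' * b' = (a - a') * b + a' * (b - b')" by (simp add: algebra_simps)
  then have "\<bar>a * b - a' * b'\<bar> \<le> \<bar>a - a'\<bar> * \<bar>b\<bar> + \<bar>a'\<bar> * \<bar>b - b'\<bar>"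
    by (metis abs_mult abs_triangle_ineq)
  also have "\<dots> \<le> \<bar>a - a'\<bar> * 1 + 1 * \<bar>b - b'\<bar>"
    using assms by (intro add_mono mult_mono) auto
  finally show ?thesis by simp
qed

text \<open>Euler's equations of a free rigid body for the body coordinates of the unit vector along
  the angular momentum; the inertia and the size of the momentum enter only through the constants
  \<open>p\<close>, \<open>q\<close>, \<open>r\<close>.\<close>

definition euler_solution_on ::
    "real set \<Rightarrow> real \<Rightarrow> real \<Rightarrow> real \<Rightarrow> (real \<Rightarrow> real) \<Rightarrow> (real \<Rightarrow> real) \<Rightarrow> (real \<Rightarrow> real) \<Rightarrow> bool" where
  "euler_solution_on T p q r x y z \<longleftrightarrow> (\<forall>t\<in>T.
     (x has_real_derivative p * (y t * z t)) (at t within T) \<and>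
     (y has_real_derivative q * (z t * x t)) (at t within T) \<and>
     (z has_real_derivative r * (x t * y t)) (at t within T))"

text \<open>Inside the unit cube the quadratic field is Lipschitz, so the squared distance
  \<open>g\<close> of two solutions satisfies a Gronwall inequality with a constant that does not
  depend on time.\<close>

lemma euler_solution_unique:
  assumes T: "is_interval T" "0 \<in> T"
    and sol: "euler_solution_on T p q r x y z" "euler_solution_on T p q r x' y' z'"
    and bound: "\<And>t. t \<in> T \<Longrightarrow> \<bar>x t\<bar> \<le> 1 \<and> \<bar>y t\<bar> \<le> 1 \<and> \<bar>z t\<bar> \<le> 1"
      "\<And>t. t \<in> T \<Longrightarrow> \<bar>x' t\<bar> \<le> 1 \<and> \<bar>y' t\<bar> \<le> 1 \<and> \<bar>z' t\<bar> \<le> 1"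
    and init: "x 0 = x' 0" "y 0 = y' 0" "z 0 = z' 0" and t: "t \<in> T"
  shows "x t = x' t" "y t = y' t" "z t = z' t"
proof -
  define g where "g = (\<lambda>t. (x t - x' t)\<^sup>2 + (y t - y' t)\<^sup>2 + (z t - z' t)\<^sup>2)"
  define g' where "g' = (\<lambda>t. 2 * (x t - x' t) * (p * (y t * z t - y' t * z' t)) +
    2 * (y t - y' t) * (q * (z t * x t - z' t * x' t)) +
    2 * (z t - z' t) * (r * (x t * y t - x' t * y' t)))"
  define K where "K = \<bar>p\<bar> + \<bar>q\<bar> + \<bar>r\<bar>"
  have "g t \<le> 0"
  proof (rule gronwall_zero[OF T _ _ _ t])
    show "(g has_real_derivative g' s) (at s within T)" if "s \<in> T" for s
      using sol that unfolding g_def g'_def euler_solution_on_def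
      by (auto intro!: derivative_eq_intros simp: algebra_simps)
    show "g 0 = 0" using init by (simp add: g_def)
    show "\<bar>g' s\<bar> \<le> (4 * K) * g s" if s: "s \<in> T" for s
    proof -
      define a b c where "a = \<bar>x s - x' s\<bar>" and "b = \<bar>y s - y' s\<bar>" and "c = \<bar>z s - z' s\<bar>"
      have pos: "0 \<le> a" "0 \<le> b" "0 \<le> c" by (simp_all add: a_def b_def c_def)
      have term_le: "\<bar>2 * u * (w * v)\<bar> \<le> 2 * \<bar>u\<bar> * (K * m)"
        if "\<bar>v\<bar> \<le> m" "\<bar>w\<bar> \<le> K" for u v w m :: real
        unfolding abs_mult using that by (intro mult_mono) auto
      \<comment> \<open>\<open>K\<close> dominates each of the three coefficients. Each mixed
        product occurs twice with factor 2, which yields the 4, and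
        \<open>a * b + b * c + c * a\<close> is at most the sum of squares.\<close>
      have "\<bar>g' s\<bar> \<le> 2 * a * (K * (b + c)) + 2 * b * (K * (c + a)) + 2 * c * (K * (a + b))"
        unfolding g'_def a_def b_def c_def
        using bound[OF s]
        by (intro order_trans[OF abs_triangle_ineq] add_mono term_le abs_mult_diff_le)
           (auto simp: K_def)
      also have "\<dots> = 4 * K * (a * b + b * c + c * a)" by (simp add: algebra_simps)
      also have "\<dots> \<le> 4 * K * (a\<^sup>2 + b\<^sup>2 + c\<^sup>2)"
      proof (rule mult_left_mono)
        have "0 \<le> (a - b)\<^sup>2 + (b - c)\<^sup>2 + (c - a)\<^sup>2" by simp
        then show "a * b + b * c + c * a \<le> a\<^sup>2 + b\<^sup>2 + c\<^sup>2"
          by (simp add: power2_eq_square algebra_simps)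
      qed (simp add: K_def)
      also have "\<dots> = (4 * K) * g s" by (simp add: g_def a_def b_def c_def)
      finally show ?thesis .
    qed
  qed
  moreover have "0 \<le> (x t - x' t)\<^sup>2" "0 \<le> (y t - y' t)\<^sup>2" "0 \<le> (z t - z' t)\<^sup>2"
    by (rule zero_le_power2)+
  ultimately have "(x t - x' t)\<^sup>2 = 0" "(y t - y' t)\<^sup>2 = 0" "(z t - z' t)\<^sup>2 = 0"
    unfolding g_def by linarith+
  then show "x t = x' t" "y t = y' t" "z t = z' t"
    by (simp_all only: power_eq_0_iff right_minus_eq)
qed

text \<open>The inhomogeneity \<open>w\<close> cancels in the difference \<open>d\<close>, and the
  rotation term is orthogonal to \<open>d\<close>. Hence the derivative of
  \<open>d \<bullet> d\<close> is \<open>- 2 * a\<close> times itself, and a bound on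
  \<open>a\<close> controls its growth.\<close>

lemma precession_unique:
  fixes u v :: "real \<Rightarrow> real^3"
  assumes T: "is_interval T" "0 \<in> T"
    and u: "\<And>t. t \<in> T \<Longrightarrow> (u has_vector_derivative w t - a t *\<^sub>R u t + b t *\<^sub>R (l \<times> u t)) (at t within T)"
    and v: "\<And>t. t \<in> T \<Longrightarrow> (v has_vector_derivative w t - a t *\<^sub>R v t + b t *\<^sub>R (l \<times> v t)) (at t within T)"
    and a: "\<And>t. t \<in> T \<Longrightarrow> \<bar>a t\<bar> \<le> C"
    and init: "u 0 = v 0" and t: "t \<in> T"
  shows "u t = v t"
proof -
  define d where "d = (\<lambda>t. u t - v t)"
  have d': "(d has_vector_derivative - a s *\<^sub>R d s + b s *\<^sub>R (l \<times> d s)) (at s within T)"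
    if "s \<in> T" for s
    using has_vector_derivative_diff[OF u[OF that] v[OF that]] unfolding d_def
    by (simp add: algebra_simps Cross3.right_diff_distrib)
  have "d t \<bullet> d t \<le> 0"
  proof (rule gronwall_zero[where g = "\<lambda>t. d t \<bullet> d t" and C = "2 * C", OF T _ _ _ t])
    show "((\<lambda>t. d t \<bullet> d t) has_real_derivative - 2 * a s * (d s \<bullet> d s)) (at s within T)"
      if "s \<in> T" for s
    proof -
      have "((\<lambda>t. d t \<bullet> d t) has_vector_derivative
          d s \<bullet> (- a s *\<^sub>R d s + b s *\<^sub>R (l \<times> d s)) + (- a s *\<^sub>R d s + b s *\<^sub>R (l \<times> d s)) \<bullet> d s)
          (at s within T)"
        using bounded_bilinear.has_vector_derivative[OF bounded_bilinear_inner d'[OF that] d'[OF that]] .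
      then show ?thesis
        by (simp add: has_real_derivative_iff_has_vector_derivative inner_simps dot_cross_self mult.assoc)
    qed
    show "\<bar>- 2 * a s * (d s \<bullet> d s)\<bar> \<le> 2 * C * (d s \<bullet> d s)" if "s \<in> T" for s
      using a[OF that] by (simp add: abs_mult mult_right_mono)
    show "d 0 \<bullet> d 0 = 0" using init by (simp add: d_def)
  qed
  then show ?thesis by (simp add: d_def flip: power2_norm_eq_inner)
qed

section \<open>The normal vector in reference coordinates\<close>

theorem theorem3p1:
  fixes Ix Iy Iz \<alpha> \<beta> :: real
    and i j k L :: "real^3"
    and T :: "real set"
    and e1 e2 n :: "real \<Rightarrow> real^3"
    and \<phi> \<theta> \<psi> :: "real \<Rightarrow> real"
  assumes inertia: "0 < Ix" "Ix \<le> Iy" "Iy < Iz"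
    and reference_frame: "right_handed_frame i j k"
    and time: "is_interval T" "0 \<in> T"
    and motion: "torque_free_motion T Ix Iy Iz L e1 e2 n"
    and L_nonzero: "norm L > 0"
    and beta: "0 < \<beta>" "\<beta> < pi"
    and L_coords: "frame_coords i j k L =
          norm L *\<^sub>R vector [cos \<alpha> * sin \<beta>, sin \<alpha> * sin \<beta>, cos \<beta>]"
    and psi_ode: "\<And>t. t \<in> T \<Longrightarrow> (\<psi> has_real_derivative
          norm L * ((cos (\<phi> t))\<^sup>2 / Ix + (sin (\<phi> t))\<^sup>2 / Iy)) (at t within T)"
    and phi_ode: "\<And>t. t \<in> T \<Longrightarrow> (\<phi> has_real_derivative
          norm L * cos (\<theta> t) * ((cos (\<phi> t))\<^sup>2 / Ix + (sin (\<phi> t))\<^sup>2 / Iy - 1 / Iz)) (at t within T)"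
    and theta_ode: "\<And>t. t \<in> T \<Longrightarrow> (\<theta> has_real_derivative
          norm L / 2 * (1 / Ix - 1 / Iy) * sin (\<theta> t) * sin (2 * \<phi> t)) (at t within T)"
    and initial: "coin_angles k L (e1 0) (e2 0) (n 0) (\<phi> 0) (\<theta> 0) (\<psi> 0)"
  shows "\<forall>t\<in>T. frame_coords i j k (n t) = vector
     [- cos \<alpha> * cos \<beta> * cos (\<psi> t) * sin (\<theta> t) + sin \<alpha> * sin (\<psi> t) * sin (\<theta> t)
        + cos \<alpha> * sin \<beta> * cos (\<theta> t),
      - sin \<alpha> * cos \<beta> * cos (\<psi> t) * sin (\<theta> t) - cos \<alpha> * sin (\<psi> t) * sin (\<theta> t)
        + sin \<alpha> * sin \<beta> * cos (\<theta> t),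
      sin \<beta> * cos (\<psi> t) * sin (\<theta> t) + cos \<beta> * cos (\<theta> t)]"
proof -
  define l M where "l = L /\<^sub>R norm L" and "M = norm L"
  have L: "L = M *\<^sub>R l" and M: "M > 0" and nl: "norm l = 1"
    using L_nonzero by (auto simp: l_def M_def)
  have l_coords: "l \<bullet> i = cos \<alpha> * sin \<beta>" "l \<bullet> j = sin \<alpha> * sin \<beta>" "l \<bullet> k = cos \<beta>"
  proof -
    have "frame_coords i j k L = vector [M * (cos \<alpha> * sin \<beta>), M * (sin \<alpha> * sin \<beta>), M * cos \<beta>]"
      unfolding L_coords M_def by (simp add: vec_eq_iff forall_3)
    then show "l \<bullet> i = cos \<alpha> * sin \<beta>" "l \<bullet> j = sin \<alpha> * sin \<beta>" "l \<bullet> k = cos \<beta>"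
      using M by (auto simp: frame_coords_eq_vector_iff L)
  qed
  have l_eq: "l = (cos \<alpha> * sin \<beta>) *\<^sub>R i + (sin \<alpha> * sin \<beta>) *\<^sub>R j + cos \<beta> *\<^sub>R k"
    using right_handed_frame_expansion[OF reference_frame, of l] by (simp add: l_coords)
  note eps = intermediate_frame[OF reference_frame beta l_eq]
  have frame: "right_handed_frame (e1 t) (e2 t) (n t)"
    and e1': "(e1 has_vector_derivative angular_velocity Ix Iy Iz L (e1 t) (e2 t) (n t) \<times> e1 t) (at t within T)"
    and e2': "(e2 has_vector_derivative angular_velocity Ix Iy Iz L (e1 t) (e2 t) (n t) \<times> e2 t) (at t within T)"
    and n': "(n has_vector_derivative angular_velocity Ix Iy Iz L (e1 t) (e2 t) (n t) \<times> n t) (at t within T)"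
    if "t \<in> T" for t
    using motion that by (auto simp: torque_free_motion_def Let_def)
  define x y z where "x = (\<lambda>t. l \<bullet> e1 t)" and "y = (\<lambda>t. l \<bullet> e2 t)" and "z = (\<lambda>t. l \<bullet> n t)"
  note cross_bilinear = cross_add_left cross_add_right cross_mult_left cross_mult_right
  \<comment> \<open>These are the coefficients produced by
    \<open>l \<bullet> (\<omega> \<times> e)\<close> for the three body vectors: for
    \<open>e1\<close> the product \<omega> \<times> \<open>e1\<close> is \<open>((L \<bullet> n) /
    Iz) *\<^sub>R e2 - ((L \<bullet> e2) / Iy) *\<^sub>R n\<close>, which gives
    \<open>p * (y * z)\<close>.\<close>
  define p q r where "p = M * (1 / Iz - 1 / Iy)" and "q = M * (1 / Ix - 1 / Iz)"
    and "r = M * (1 / Iy - 1 / Ix)"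
  have sol: "euler_solution_on T p q r x y z"
    unfolding euler_solution_on_def
  proof (intro ballI conjI)
    fix t assume t: "t \<in> T"
    note cr = right_handed_frame_cross[OF frame[OF t]]
    have inner': "((\<lambda>t. l \<bullet> f t) has_real_derivative l \<bullet> D) (at t within T)"
      if "(f has_vector_derivative D) (at t within T)" for f D
      using bounded_linear.has_vector_derivative[OF bounded_linear_inner_right that]
      by (simp add: has_real_derivative_iff_has_vector_derivative)
    show "(x has_real_derivative p * (y t * z t)) (at t within T)"
      using inner'[OF e1'[OF t]]
      by (simp add: angular_velocity_def cross_bilinear cr inner_simps L x_def y_def z_def p_def
          algebra_simps)
    show "(y has_real_derivative q * (z t * x t)) (at t within T)"
      using inner'[OF e2'[OF t]]
      by (simp add: angular_velocity_def cross_bilinear cr inner_simps L x_def y_def z_def q_def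
          algebra_simps)
    show "(z has_real_derivative r * (x t * y t)) (at t within T)"
      using inner'[OF n'[OF t]]
      by (simp add: angular_velocity_def cross_bilinear cr inner_simps L x_def y_def z_def r_def
          algebra_simps)
  qed
  \<comment> \<open>\<open>M * A\<close> is the precession rate of \<open>\<psi>\<close>, and
    \<open>B\<close> is chosen so that the equation for \<open>\<theta>\<close> reads
    \<open>\<theta>' = - B * sin \<theta>\<close>.\<close>
  define A where "A = (\<lambda>t. (cos (\<phi> t))\<^sup>2 / Ix + (sin (\<phi> t))\<^sup>2 / Iy)"
  define B where "B = (\<lambda>t. r * (cos (\<phi> t) * sin (\<phi> t)))"
  have phi': "(\<phi> has_real_derivative M * cos (\<theta> t) * (A t - 1 / Iz)) (at t within T)"
    and psi': "(\<psi> has_real_derivative M * A t) (at t within T)"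
    and theta': "(\<theta> has_real_derivative - B t * sin (\<theta> t)) (at t within T)"
    if "t \<in> T" for t
  proof -
    have "norm L / 2 * (1 / Ix - 1 / Iy) * sin (\<theta> t) * sin (2 * \<phi> t) = - B t * sin (\<theta> t)"
      unfolding sin_double by (simp add: B_def M_def r_def algebra_simps)
    then show "(\<theta> has_real_derivative - B t * sin (\<theta> t)) (at t within T)"
      using theta_ode[OF that] by simp
  qed (use phi_ode[OF that] psi_ode[OF that] in \<open>simp_all add: A_def M_def\<close>)
  \<comment> \<open>\<open>A1\<close> and \<open>A2\<close> trade the constants
    \<open>M / Iy\<close> and \<open>M / Ix\<close> for \<open>A\<close> and \<open>r\<close>. They
    carry the Pythagorean identity in \<phi>, so that the derivative checks for the spherical
    coordinates and the splitting of \<open>n'\<close> become purely algebraic.\<close>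
  have A1: "cos (\<phi> t) * r * cos (\<phi> t) + M * A t = M / Iy" for t
  proof -
    have "cos (\<phi> t) * r * cos (\<phi> t) + M * A t = M / Iy * (cos (\<phi> t))\<^sup>2 + M / Iy * (sin (\<phi> t))\<^sup>2"
      by (simp add: A_def r_def power2_eq_square algebra_simps)
    then show ?thesis by (simp only: sin_cos_squared_add2 mult_1_right flip: distrib_left)
  qed
  have A2: "M * A t - sin (\<phi> t) * r * sin (\<phi> t) = M / Ix" for t
  proof -
    have "M * A t - sin (\<phi> t) * r * sin (\<phi> t) = M / Ix * (cos (\<phi> t))\<^sup>2 + M / Ix * (sin (\<phi> t))\<^sup>2"
      by (simp add: A_def r_def power2_eq_square algebra_simps)
    then show ?thesis by (simp only: sin_cos_squared_add2 mult_1_right flip: distrib_left)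
  qed
  have sol': "euler_solution_on T p q r (\<lambda>t. cos (\<phi> t) * sin (\<theta> t)) (\<lambda>t. sin (\<phi> t) * sin (\<theta> t))
      (\<lambda>t. cos (\<theta> t))"
    unfolding euler_solution_on_def
  proof (intro ballI conjI)
    fix t assume t: "t \<in> T"
    have *: "p = M / Iz - (cos (\<phi> t) * r * cos (\<phi> t) + M * A t)"
      "q = (M * A t - sin (\<phi> t) * r * sin (\<phi> t)) - M / Iz"
      unfolding A1 A2 by (simp_all add: p_def q_def algebra_simps)
    show "((\<lambda>t. cos (\<phi> t) * sin (\<theta> t)) has_real_derivative
        p * (sin (\<phi> t) * sin (\<theta> t) * cos (\<theta> t))) (at t within T)"
      unfolding * by (auto intro!: derivative_eq_intros phi'[OF t] theta'[OF t]
          simp: B_def algebra_simps)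
    show "((\<lambda>t. sin (\<phi> t) * sin (\<theta> t)) has_real_derivative
        q * (cos (\<theta> t) * (cos (\<phi> t) * sin (\<theta> t)))) (at t within T)"
      unfolding * by (auto intro!: derivative_eq_intros phi'[OF t] theta'[OF t]
          simp: B_def algebra_simps)
    show "((\<lambda>t. cos (\<theta> t)) has_real_derivative
        r * (cos (\<phi> t) * sin (\<theta> t) * (sin (\<phi> t) * sin (\<theta> t)))) (at t within T)"
      by (auto intro!: derivative_eq_intros theta'[OF t] simp: B_def algebra_simps)
  qed
  have init: "x 0 = cos (\<phi> 0) * sin (\<theta> 0)" "y 0 = sin (\<phi> 0) * sin (\<theta> 0)" "z 0 = cos (\<theta> 0)"
    and init_n: "n 0 = (sin (\<theta> 0) * cos (\<psi> 0)) *\<^sub>R eps1 k l + (sin (\<theta> 0) * sin (\<psi> 0)) *\<^sub>R eps2 k l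
      + cos (\<theta> 0) *\<^sub>R l"
    using initial
    unfolding coin_angles_def Let_def l_def[symmetric] frame_coords_eq_vector_iff x_def y_def z_def
    by blast+
  have bound: "\<bar>x t\<bar> \<le> 1 \<and> \<bar>y t\<bar> \<le> 1 \<and> \<bar>z t\<bar> \<le> 1" if "t \<in> T" for t
    using frame[OF that] Cauchy_Schwarz_ineq2[of l] nl
    by (simp add: right_handed_frame_def x_def y_def z_def) (metis mult_1)
  have bound': "\<bar>cos (\<phi> t) * sin (\<theta> t)\<bar> \<le> 1 \<and> \<bar>sin (\<phi> t) * sin (\<theta> t)\<bar> \<le> 1 \<and> \<bar>cos (\<theta> t)\<bar> \<le> 1"
    for t
    by (auto simp: abs_mult intro!: mult_le_one)
  have xyz: "x t = cos (\<phi> t) * sin (\<theta> t)" "y t = sin (\<phi> t) * sin (\<theta> t)" "z t = cos (\<theta> t)"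
    if "t \<in> T" for t
    using euler_solution_unique[OF time sol sol' bound bound' init that] by auto
  define m where "m = (\<lambda>t. (sin (\<theta> t) * cos (\<psi> t)) *\<^sub>R eps1 k l
    + (sin (\<theta> t) * sin (\<psi> t)) *\<^sub>R eps2 k l + cos (\<theta> t) *\<^sub>R l)"
  have n_m: "n t = m t" if "t \<in> T" for t
  proof (rule precession_unique[OF time _ _ _ _ that])
    fix t assume t: "t \<in> T"
    note cr = right_handed_frame_cross[OF frame[OF t]]
    have l: "l = x t *\<^sub>R e1 t + y t *\<^sub>R e2 t + z t *\<^sub>R n t"
      unfolding x_def y_def z_def by (rule right_handed_frame_expansion[OF frame[OF t]])
    have "angular_velocity Ix Iy Iz L (e1 t) (e2 t) (n t) \<times> n t
        = ((M / Iy) * y t) *\<^sub>R e1 t - ((M / Ix) * x t) *\<^sub>R e2 t"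
      by (simp add: angular_velocity_def cross_bilinear cr L x_def y_def)
    \<comment> \<open>The velocity of \<open>n\<close> is split along the projection of
      \<open>l\<close> to the plane orthogonal to \<open>n\<close> (nutation) and along
      \<open>l \<times> n\<close> (precession about \<open>l\<close>). The splitting uses
      \<open>x = cos \<phi> * sin \<theta>\<close> and \<open>y = sin \<phi> * sin \<theta>\<close>,
      known from uniqueness for Euler's equations.\<close>
    also have "\<dots> = B t *\<^sub>R (x t *\<^sub>R e1 t + y t *\<^sub>R e2 t) + (M * A t) *\<^sub>R (y t *\<^sub>R e1 t - x t *\<^sub>R e2 t)"
      unfolding A1[of t, symmetric] A2[of t, symmetric]
      by (simp add: xyz[OF t] B_def algebra_simps)
    also have "x t *\<^sub>R e1 t + y t *\<^sub>R e2 t = l - cos (\<theta> t) *\<^sub>R n t"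
      by (subst l) (simp add: xyz[OF t])
    also have "y t *\<^sub>R e1 t - x t *\<^sub>R e2 t = l \<times> n t"
      by (subst l) (simp add: cross_bilinear cr)
    also have "B t *\<^sub>R (l - cos (\<theta> t) *\<^sub>R n t) = B t *\<^sub>R l - (B t * cos (\<theta> t)) *\<^sub>R n t"
      by (simp add: algebra_simps)
    finally show "(n has_vector_derivative
        B t *\<^sub>R l - (B t * cos (\<theta> t)) *\<^sub>R n t + (M * A t) *\<^sub>R (l \<times> n t)) (at t within T)"
      using n'[OF t] by simp
    \<comment> \<open>Needed for the component along \<open>l\<close>: differentiating
      \<open>cos \<theta>\<close> gives B sin \<theta> sin \<theta>, whereas the linear equation
      gives B (1 - cos \<theta> cos \<theta>).\<close>
    have c2: "cos (\<theta> t) * cos (\<theta> t) = 1 - sin (\<theta> t) * sin (\<theta> t)"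
      by (metis cos_squared_eq power2_eq_square)
    have "B t *\<^sub>R l - (B t * cos (\<theta> t)) *\<^sub>R m t + (M * A t) *\<^sub>R (l \<times> m t) =
      (- B t * sin (\<theta> t) * cos (\<theta> t) * cos (\<psi> t) - M * A t * sin (\<theta> t) * sin (\<psi> t)) *\<^sub>R eps1 k l
      + (- B t * sin (\<theta> t) * cos (\<theta> t) * sin (\<psi> t) + M * A t * sin (\<theta> t) * cos (\<psi> t)) *\<^sub>R eps2 k l
      + (B t * (1 - cos (\<theta> t) * cos (\<theta> t))) *\<^sub>R l"
      by (simp add: m_def cross_bilinear eps(3) eps2_def[symmetric] algebra_simps)
    then show "(m has_vector_derivative
        B t *\<^sub>R l - (B t * cos (\<theta> t)) *\<^sub>R m t + (M * A t) *\<^sub>R (l \<times> m t)) (at t within T)"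
      unfolding c2 m_def[abs_def]
      by (auto intro!: derivative_eq_intros theta'[OF t] psi'[OF t] simp: algebra_simps)
    show "\<bar>B t * cos (\<theta> t)\<bar> \<le> \<bar>r\<bar>"
      unfolding B_def abs_mult mult.assoc
      by (intro mult_left_le mult_le_one mult_nonneg_nonneg) auto
  qed (simp add: init_n m_def)
  show ?thesis
  proof
    fix t assume "t \<in> T"
    have F: "i \<bullet> i = 1" "j \<bullet> j = 1" "k \<bullet> k = 1" "i \<bullet> j = 0" "j \<bullet> i = 0" "i \<bullet> k = 0" "k \<bullet> i = 0"
      "j \<bullet> k = 0" "k \<bullet> j = 0"
      using reference_frame by (auto simp: right_handed_frame_def norm_eq_1 inner_commute)
    show "frame_coords i j k (n t) = vector
     [- cos \<alpha> * cos \<beta> * cos (\<psi> t) * sin (\<theta> t) + sin \<alpha> * sin (\<psi> t) * sin (\<theta> t)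
        + cos \<alpha> * sin \<beta> * cos (\<theta> t),
      - sin \<alpha> * cos \<beta> * cos (\<psi> t) * sin (\<theta> t) - cos \<alpha> * sin (\<psi> t) * sin (\<theta> t)
        + sin \<alpha> * sin \<beta> * cos (\<theta> t),
      sin \<beta> * cos (\<psi> t) * sin (\<theta> t) + cos \<beta> * cos (\<theta> t)]"
      unfolding frame_coords_eq_vector_iff n_m[OF \<open>t \<in> T\<close>] m_def
      by (simp add: eps(1,2) inner_simps l_coords F algebra_simps)
  qed
qed

end
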